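(* Let $d\ge 1$ be an integer, let $\mathcal{X}=\{-1,1\}^d$, and let $\mathcal{F}^{\oplus}=\{f_S: x\mapsto \prod_{i\in S}x_i \mid S\subseteq\{1,\dots,d\}\}$ (real-valued functions on $\mathcal{X}$). Then: (i) $\mathcal{M}_0\text{-}\mathsf{rk}(\mathcal{F}^{\oplus},R)\ \ge\ 2^{d/2}-1$ for all $R>0$. (ii) $\underline{\mathsf{Sdim}}(\mathcal{F}^{\oplus},\varepsilon)\ \le\ \underline{\mathsf{Edim}}(\mathcal{F}^{\oplus},\varepsilon)\ \le\ d$ for all $\varepsilon\ge 0$.
   Context: Generalized rank: let $\mathcal{B}_d(R)=\{x\in\mathbb{R}^d:\|x\|_2\le R\}$. For $\sigma:\mathbb{R}\to\mathbb{R}$, a class $\mathcal{F}$ of functions $\mathcal{X}\to\mathbb{R}$ and $R>0$, $\sigma\text{-}\mathsf{rk}(\mathcal{F},R)$ is the smallest $d$ for which there exist maps $\phi:\mathcal{X}\to\mathcal{B}_d(1)$ and $w:\mathcal{F}\to\mathcal{B}_d(R)$ with $f(x)=\sigma(\langle w(f),\phi(x)\rangle)$ for all $(x,f)\in\mathcal{X}\times\mathcal{F}$, or $\infty$ if no such $d$ exists. For a set $\Sigma$ of activations, $\Sigma\text{-}\mathsf{rk}(\mathcal{F},R)=\min_{\sigma\in\Sigma}\sigma\text{-}\mathsf{rk}(\mathcal{F},R)$. $\mathcal{M}_0$ is the set of all $\sigma:\mathbb{R}\to\mathbb{R}$ such that $0\le \frac{\sigma(z')-\sigma(z)}{z'-z}\le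 1$ for all $z<z'$ (nondecreasing and 1-Lipschitz). Exact eluder dimension: for $f^\star\in\mathcal{F}$ and $\varepsilon\ge0$, $\underline{\mathsf{Edim}}_{f^\star}(\mathcal{F},\varepsilon)$ is the largest $m$ such that there exist $(x_1,f_1),\dots,(x_m,f_m)\in\mathcal{X}\times\mathcal{F}$ with, for all $i\in\{1,\dots,m\}$, $|f_i(x_i)-f^\star(x_i)|>\varepsilon$ and $\sum_{j<i}(f_i(x_j)-f^\star(x_j))^2\le\varepsilon^2$. Exact star number: $\underline{\mathsf{Sdim}}_{f^\star}(\mathcal{F},\varepsilon)$ is defined identically but with $\sum_{j<i}$ replaced by $\sum_{j\ne i}$. Finally $\underline{\mathsf{Edim}}(\mathcal{F},\varepsilon)=\sup_{f^\star\in\mathcal{F}}\underline{\mathsf{Edim}}_{f^\star}(\mathcal{F},\varepsilon)$ and $\underline{\mathsf{Sdim}}(\mathcal{F},\varepsilon)=\sup_{f^\star\in\mathcal{F}}\underline{\mathsf{Sdim}}_{f^\star}(\mathcal{F},\varepsilon)$. *)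

theory Defs
  imports "HOL-Analysis.Analysis"
begin

(* The dimension k varies inside the definition of the rank, so a vector of R^k is a function
   on the index set {..<k}, extended by undefined. *)
definition l2_ball :: "nat \<Rightarrow> real \<Rightarrow> (nat \<Rightarrow> real) set" where
  "l2_ball k R = {v \<in> extensional {..<k}. L2_set v {..<k} \<le> R}"

definition dot :: "nat \<Rightarrow> (nat \<Rightarrow> real) \<Rightarrow> (nat \<Rightarrow> real) \<Rightarrow> real" where
  "dot k u v = (\<Sum>i<k. u i * v i)"

(* A class of functions on a set X is a set of functions that are only evaluated on X. The infimum
   in enat is a minimum when the set is nonempty, and \<infinity> when it is empty. *)
definition act_rk :: "(real \<Rightarrow> real) \<Rightarrow> 'a set \<Rightarrow> ('a \<Rightarrow> real) set \<Rightarrow> real \<Rightarrow> enat" where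
  "act_rk \<sigma> X F R = Inf {enat k | k. \<exists>\<phi> w. \<phi> \<in> X \<rightarrow> l2_ball k 1 \<and> w \<in> F \<rightarrow> l2_ball k R \<and>
     (\<forall>x\<in>X. \<forall>f\<in>F. f x = \<sigma> (dot k (w f) (\<phi> x)))}"

definition class_rk :: "(real \<Rightarrow> real) set \<Rightarrow> 'a set \<Rightarrow> ('a \<Rightarrow> real) set \<Rightarrow> real \<Rightarrow> enat" where
  "class_rk \<Sigma> X F R = (INF \<sigma>\<in>\<Sigma>. act_rk \<sigma> X F R)"

definition M0 :: "(real \<Rightarrow> real) set" where
  "M0 = {\<sigma>. \<forall>z z'. z < z' \<longrightarrow> 0 \<le> (\<sigma> z' - \<sigma> z) / (z' - z) \<and> (\<sigma> z' - \<sigma> z) / (z' - z) \<le> 1}"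

(* Both dimensions are \<infinity> if there are arbitrarily long sequences; m = 0 is always admissible. *)
definition Edim_at :: "'a set \<Rightarrow> ('a \<Rightarrow> real) set \<Rightarrow> real \<Rightarrow> ('a \<Rightarrow> real) \<Rightarrow> enat" where
  "Edim_at X F \<epsilon> g = Sup {enat m | m. \<exists>(x :: nat \<Rightarrow> 'a) (f :: nat \<Rightarrow> 'a \<Rightarrow> real).
     \<forall>i\<in>{1..m}. x i \<in> X \<and> f i \<in> F \<and>
       \<bar>f i (x i) - g (x i)\<bar> > \<epsilon> \<and> (\<Sum>j\<in>{1..<i}. (f i (x j) - g (x j))\<^sup>2) \<le> \<epsilon>\<^sup>2}"

definition Sdim_at :: "'a set \<Rightarrow> ('a \<Rightarrow> real) set \<Rightarrow> real \<Rightarrow> ('a \<Rightarrow> real) \<Rightarrow> enat" where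
  "Sdim_at X F \<epsilon> g = Sup {enat m | m. \<exists>(x :: nat \<Rightarrow> 'a) (f :: nat \<Rightarrow> 'a \<Rightarrow> real).
     \<forall>i\<in>{1..m}. x i \<in> X \<and> f i \<in> F \<and>
       \<bar>f i (x i) - g (x i)\<bar> > \<epsilon> \<and> (\<Sum>j\<in>{1..m} - {i}. (f i (x j) - g (x j))\<^sup>2) \<le> \<epsilon>\<^sup>2}"

definition Edim :: "'a set \<Rightarrow> ('a \<Rightarrow> real) set \<Rightarrow> real \<Rightarrow> enat" where
  "Edim X F \<epsilon> = (SUP g\<in>F. Edim_at X F \<epsilon> g)"

definition Sdim :: "'a set \<Rightarrow> ('a \<Rightarrow> real) set \<Rightarrow> real \<Rightarrow> enat" where
  "Sdim X F \<epsilon> = (SUP g\<in>F. Sdim_at X F \<epsilon> g)"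

definition cube :: "nat \<Rightarrow> (nat \<Rightarrow> real) set" where
  "cube d = {1..d} \<rightarrow>\<^sub>E {-1, 1}"

definition parities :: "nat \<Rightarrow> ((nat \<Rightarrow> real) \<Rightarrow> real) set" where
  "parities d = {restrict (\<lambda>x. \<Prod>i\<in>S. x i) (cube d) | S. S \<subseteq> {1..d}}"

end

theory Submission
  imports Defs "Jordan_Normal_Form.Determinant"
begin

text \<open>For (i), a nondecreasing activation takes the values \<open>1\<close> and \<open>-1\<close> on separated sets, so subtracting a
  threshold turns a \<open>k\<close>-dimensional representation into a sign representation of the Hadamard matrix of
  parities in dimension \<open>k + 1\<close>, and Forster's sign-rank bound gives \<open>k + 1 \<ge> sqrt (2 ^ d)\<close>.
  Instead of moving the vectors into general position, as Forster does, we replace every vector by a whole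
  basis close to it; this makes the potential of the isotropic-position argument bounded at once, and a
  near-maximiser suffices.
  For (ii), two parities differ by \<open>0\<close> or \<open>2\<close> at any point, so an eluder sequence is a sequence of points of
  \<open>F\<^sub>2\<^sup>d\<close> none of which is in the span of its predecessors.\<close>

unbundle no inner_syntax and no vec_syntax

section \<open>Forster's sign-rank bound\<close>

text \<open>The matrix determinant lemma, by computing one block determinant through both of its
  Schur complements. It gives the determinant of the stretching map in the isotropic position
  argument and of the bases built near a given vector.\<close>

lemma det_one_plus_outer:
  fixes u v :: "real Matrix.vec"
  assumes u: "u \<in> carrier_vec n" and v: "v \<in> carrier_vec n"
  shows "det (1\<^sub>m n + mat n n (\<lambda>(i,j). u $ i * v $ j)) = 1 + u \<bullet> v"
proof -
  define U where "U = mat n 1 (\<lambda>(i,j). u $ i)"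
  define V where "V = mat 1 n (\<lambda>(i,j). v $ j)"
  define O' where "O' = mat n n (\<lambda>(i,j). u $ i * v $ j)"
  have c: "U \<in> carrier_mat n 1" "V \<in> carrier_mat 1 n" "O' \<in> carrier_mat n n"
    unfolding U_def V_def O'_def by auto
  have UV: "U * V = O'"
    by (rule eq_matI) (auto simp: U_def V_def O'_def scalar_prod_def)
  have VU: "V * U = mat 1 1 (\<lambda>_. u \<bullet> v)"
    using u v by (intro eq_matI) (auto simp: U_def V_def scalar_prod_def mult.commute)
  \<comment> \<open>\<open>F\<close> has two block triangular factorisations: eliminating the top
    left block leaves the 1 by 1 complement \<open>1 + u \<bullet> v\<close>, eliminating the bottom
    right block leaves \<open>1\<^sub>m n + O'\<close>.\<close>
  define F where "F = four_block_mat (1\<^sub>m n) (- U) V (1\<^sub>m 1)"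
  have "F = four_block_mat (1\<^sub>m n) (0\<^sub>m n 1) V (1\<^sub>m 1)
      * four_block_mat (1\<^sub>m n) (- U) (0\<^sub>m 1 n) (1\<^sub>m 1 + V * U)"
    (is "_ = ?L * ?R")
  proof -
    have "V * (- U) + 1\<^sub>m 1 * (1\<^sub>m 1 + V * U) = 1\<^sub>m 1"
      using c by (intro eq_matI) (auto simp: VU)
    then show ?thesis unfolding F_def
      using c by (subst mult_four_block_mat[where ?nr1.0 = n and ?n1.0 = n and
            ?n2.0 = 1 and ?nr2.0 = 1 and ?nc1.0 = n and ?nc2.0 = 1]) auto
  qed
  moreover have "det (?L * ?R) = 1 + u \<bullet> v"
  proof -
    have "det (?L * ?R) = det ?L * det ?R" using c by (intro det_mult[of _ "n+1"]) auto
    also have "det ?L = 1" using c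
      by (subst det_four_block_mat_upper_right_zero[of _ n _ 1]) auto
    also have "det ?R = det (1\<^sub>m 1 + V * U)" using c
      by (subst det_four_block_mat_lower_left_zero[of _ n _ 1]) auto
    also have "\<dots> = 1 + u \<bullet> v" unfolding VU by (subst det_single) auto
    finally show ?thesis by simp
  qed
  moreover have "F = four_block_mat (1\<^sub>m n + O') (- U) (0\<^sub>m 1 n) (1\<^sub>m 1)
      * four_block_mat (1\<^sub>m n) (0\<^sub>m n 1) V (1\<^sub>m 1)"
    (is "_ = ?L * ?R")
  proof -
    have "(1\<^sub>m n + O') * 1\<^sub>m n + (- U) * V = 1\<^sub>m n"
      using c by (intro eq_matI) (auto simp: UV)
    then show ?thesis unfolding F_def
      using c by (subst mult_four_block_mat[where ?nr1.0 = n and ?n1.0 = n and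
            ?n2.0 = 1 and ?nr2.0 = 1 and ?nc1.0 = n and ?nc2.0 = 1]) auto
  qed
  moreover have "det (?L * ?R) = det (1\<^sub>m n + O')"
  proof -
    have "det (?L * ?R) = det ?L * det ?R" using c by (intro det_mult[of _ "n+1"]) auto
    also have "det ?L = det (1\<^sub>m n + O')" using c
      by (subst det_four_block_mat_lower_left_zero[of _ n _ 1]) auto
    also have "det ?R = 1" using c
      by (subst det_four_block_mat_upper_right_zero[of _ n _ 1]) auto
    finally show ?thesis by simp
  qed
  ultimately show ?thesis unfolding O'_def by simp
qed

lemma scalar_prod_self_nonneg: "0 \<le> v \<bullet> (v :: real Matrix.vec)"
  by (simp add: scalar_prod_def sum_nonneg)

lemma index_sq_le_scalar_prod_self:
  "i < dim_vec v \<Longrightarrow> (v $ i)\<^sup>2 \<le> v \<bullet> (v :: real Matrix.vec)"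
  unfolding scalar_prod_def
  using member_le_sum[of i "{0..<dim_vec v}" "\<lambda>i. v $ i * v $ i"] by (simp add: power2_eq_square)

lemma scalar_prod_Cauchy_Schwarz:
  fixes u v :: "real Matrix.vec"
  assumes "u \<in> carrier_vec n" "v \<in> carrier_vec n"
  shows "(u \<bullet> v)\<^sup>2 \<le> (u \<bullet> u) * (v \<bullet> v)"
  using assms Cauchy_Schwarz_ineq_sum[of "($) u" "($) v" "{0..<n}"]
  by (simp add: scalar_prod_def power2_eq_square)

text \<open>A crude form of Hadamard's inequality; the constant is irrelevant here.\<close>
lemma det_sq_le_prod_cols:
  fixes A :: "real mat"
  assumes A: "A \<in> carrier_mat n n"
  shows "(det A)\<^sup>2 \<le> (fact n)\<^sup>2 * (\<Prod>j<n. col A j \<bullet> col A j)"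
proof -
  define P where "P = (\<Prod>j<n. sqrt (col A j \<bullet> col A j))"
  have perm_term: "\<bar>signof p * (\<Prod>i = 0..<n. A $$ (i, p i))\<bar> \<le> P" if p: "p permutes {0..<n}" for p
  proof -
    have "\<bar>signof p * (\<Prod>i = 0..<n. A $$ (i, p i))\<bar> = (\<Prod>i = 0..<n. \<bar>A $$ (i, p i)\<bar>)"
      by (simp add: abs_mult abs_prod sign_def)
    also have "\<dots> \<le> (\<Prod>i = 0..<n. sqrt (col A (p i) \<bullet> col A (p i)))"
    proof (rule prod_mono, intro conjI)
      fix i assume i: "i \<in> {0..<n}"
      have "p i < n" using permutes_in_image[OF p] i by auto
      then have "(A $$ (i, p i))\<^sup>2 \<le> col A (p i) \<bullet> col A (p i)"
        using index_sq_le_scalar_prod_self[of i "col A (p i)"] A i by auto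
      then show "\<bar>A $$ (i, p i)\<bar> \<le> sqrt (col A (p i) \<bullet> col A (p i))"
        by (metis real_sqrt_abs real_sqrt_le_mono)
    qed auto
    also have "\<dots> = P"
      unfolding P_def using prod.permute[OF p, of "\<lambda>j. sqrt (col A j \<bullet> col A j)"]
      by (simp add: atLeast0LessThan o_def)
    finally show ?thesis .
  qed
  have "\<bar>det A\<bar> \<le> (\<Sum>p | p permutes {0..<n}. \<bar>signof p * (\<Prod>i = 0..<n. A $$ (i, p i))\<bar>)"
    unfolding det_def'[OF A] by (rule sum_abs)
  also have "\<dots> \<le> (\<Sum>p | p permutes {0..<n}. P)" using perm_term by (intro sum_mono) auto
  also have "\<dots> = fact n * P" by (simp add: card_permutations)
  finally have "(det A)\<^sup>2 \<le> (fact n * P)\<^sup>2" by (metis abs_ge_zero power2_abs power_mono)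
  also have "(fact n * P)\<^sup>2 = (fact n)\<^sup>2 * (\<Prod>j<n. col A j \<bullet> col A j)"
    unfolding P_def power_mult_distrib prod_power_distrib by (simp add: scalar_prod_self_nonneg)
  finally show ?thesis .
qed

section \<open>Radial isotropic position\<close>

text \<open>For a unit vector \<open>y\<close> this map scales the direction \<open>y\<close> by
  \<open>1 + c\<close> and fixes its orthogonal complement. The matrix is written in the shape of
  \<open>det_one_plus_outer\<close>, so its determinant is available too.\<close>

lemma stretch_mult_vec:
  fixes y b :: "real Matrix.vec"
  assumes "y \<in> carrier_vec n" "b \<in> carrier_vec n"
  shows "(1\<^sub>m n + mat n n (\<lambda>(i,j). (c \<cdot>\<^sub>v y) $ i * y $ j)) *\<^sub>v b = b + (c * (y \<bullet> b)) \<cdot>\<^sub>v y"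
  using assms
  by (intro eq_vecI)
     (auto simp: add_mult_distrib_mat_vec[where nr=n and nc=n] scalar_prod_def sum_distrib_left mult_ac)

text \<open>Forster's radial isotropic position. The potential \<open>\<Psi>\<close> is bounded since every \<open>B x\<close> is a basis,
  and at a near-maximiser stretching by \<open>sqrt (1 + s)\<close> along \<open>y\<close> cannot gain more than a factor \<open>exp (s\<^sup>2)\<close>.\<close>
lemma approx_isotropic_position:
  fixes B :: "'a \<Rightarrow> real mat"
  assumes X: "finite X"
    and B: "\<And>x. x \<in> X \<Longrightarrow> B x \<in> carrier_mat k k" and detB: "\<And>x. x \<in> X \<Longrightarrow> det (B x) \<noteq> 0"
    and e: "0 < e"
  obtains A where "A \<in> carrier_mat k k" "det A \<noteq> 0"
    "\<And>y. y \<in> carrier_vec k \<Longrightarrow> y \<bullet> y = 1 \<Longrightarrow>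
       (1 - e) * real (card X) \<le> (\<Sum>x\<in>X. \<Sum>j<k. (y \<bullet> (A *\<^sub>v col (B x) j))\<^sup>2
          / ((A *\<^sub>v col (B x) j) \<bullet> (A *\<^sub>v col (B x) j)))"
proof (cases "X = {}")
  case True
  then show ?thesis using that[of "1\<^sub>m k"] by simp
next
  case False
  define n where "n = card X"
  have n: "n \<ge> 1" using False X by (simp add: n_def Suc_le_eq card_gt_0_iff)
  define q where "q A x j = (A *\<^sub>v col (B x) j) \<bullet> (A *\<^sub>v col (B x) j)" for A x j
  \<comment> \<open>Each factor compares the squared volume scaling of \<open>A\<close> with the
    squared lengths of the images of one basis; it does not change when \<open>A\<close> is
    multiplied by a nonzero scalar.\<close>
  define \<Psi> where "\<Psi> A = (\<Prod>x\<in>X. (det A)\<^sup>2 / (\<Prod>j<k. q A x j))" for A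
  define \<A> where "\<A> = {A \<in> carrier_mat k k. det A \<noteq> (0::real)}"
  \<comment> \<open>The column bound applied to \<open>A * B x\<close>, whose columns are the images
    of the basis vectors. As \<open>det (B x)\<close> is nonzero, this bounds \<open>\<Psi>\<close>
    and keeps its denominators positive.\<close>
  have hadamard: "(det A * det (B x))\<^sup>2 \<le> (fact k)\<^sup>2 * (\<Prod>j<k. q A x j)"
    if "A \<in> \<A>" "x \<in> X" for A x
  proof -
    have A: "A \<in> carrier_mat k k" using that by (simp add: \<A>_def)
    have "(det (A * B x))\<^sup>2 \<le> (fact k)\<^sup>2 * (\<Prod>j<k. col (A * B x) j \<bullet> col (A * B x) j)"
      using A B[OF that(2)] by (intro det_sq_le_prod_cols) auto
    also have "(\<Prod>j<k. col (A * B x) j \<bullet> col (A * B x) j) = (\<Prod>j<k. q A x j)"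
      using A B[OF that(2)] by (intro prod.cong) (simp_all add: q_def col_mult2 del: col_mult)
    finally show ?thesis using det_mult[OF A B[OF that(2)]] by simp
  qed
  have q_pos: "q A x j > 0" if "A \<in> \<A>" "x \<in> X" "j < k" for A x j
  proof -
    have "0 < (det A * det (B x))\<^sup>2" using that detB by (simp add: \<A>_def)
    with hadamard[OF that(1,2)] have "(\<Prod>j<k. q A x j) \<noteq> 0"
      by (metis mult_zero_right not_less)
    then have "q A x j \<noteq> 0" using that(3) by auto
    moreover have "q A x j \<ge> 0" by (simp add: q_def scalar_prod_self_nonneg)
    ultimately show ?thesis by simp
  qed
  have \<Psi>_pos: "\<Psi> A > 0" if "A \<in> \<A>" for A
    unfolding \<Psi>_def using that q_pos by (auto intro!: prod_pos divide_pos_pos simp: \<A>_def)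
  have bdd: "bdd_above (\<Psi> ` \<A>)"
  proof (rule bdd_aboveI2)
    fix A assume A: "A \<in> \<A>"
    show "\<Psi> A \<le> (\<Prod>x\<in>X. (fact k)\<^sup>2 / (det (B x))\<^sup>2)"
      unfolding \<Psi>_def
    proof (rule prod_mono, intro conjI)
      fix x assume x: "x \<in> X"
      have "0 < (\<Prod>j<k. q A x j)" using q_pos A x by (auto intro!: prod_pos)
      then show "0 \<le> (det A)\<^sup>2 / (\<Prod>j<k. q A x j)" by simp
      show "(det A)\<^sup>2 / (\<Prod>j<k. q A x j) \<le> (fact k)\<^sup>2 / (det (B x))\<^sup>2"
        using hadamard[OF A x] \<open>0 < (\<Prod>j<k. q A x j)\<close> detB[OF x]
        by (simp add: divide_simps power_mult_distrib mult_ac)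
    qed
  qed
  have one: "1\<^sub>m k \<in> \<A>" by (simp add: \<A>_def)
  define M where "M = Sup (\<Psi> ` \<A>)"
  have le_M: "\<Psi> A \<le> M" if "A \<in> \<A>" for A
    unfolding M_def using that bdd by (intro cSup_upper) auto
  have "M > 0" using le_M[OF one] \<Psi>_pos[OF one] by simp
  \<comment> \<open>The final estimate loses a factor \<open>1 - 2 * s\<close>, hence the choice of
    \<open>e / 2\<close>; \<open>s \<le> 1\<close> is for the bound on
    \<open>ln (1 + s)\<close>.\<close>
  define s where "s = min 1 (e / 2)"
  have s: "0 < s" "s \<le> 1" "2 * s \<le> e" using e by (auto simp: s_def)
  have "M * exp (- s\<^sup>2) < M" using \<open>M > 0\<close> s by simp
  then have "M * exp (- s\<^sup>2) < Sup (\<Psi> ` \<A>)" by (simp add: M_def)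
  moreover have "\<Psi> ` \<A> \<noteq> {}" using one by blast
  \<comment> \<open>The slack \<open>exp (- s\<^sup>2)\<close> is of second order in the stretch, so
    it cannot hide a first-order gain. The supremum need not be attained.\<close>
  ultimately obtain a where "a \<in> \<Psi> ` \<A>" "M * exp (- s\<^sup>2) < a" by (rule less_cSupE)
  then obtain A where A: "A \<in> \<A>" "M * exp (- s\<^sup>2) < \<Psi> A" by blast
  have Ac: "A \<in> carrier_mat k k" and detA: "det A \<noteq> 0" using A by (auto simp: \<A>_def)
  have "(1 - e) * real (card X) \<le> (\<Sum>x\<in>X. \<Sum>j<k. (y \<bullet> (A *\<^sub>v col (B x) j))\<^sup>2 / q A x j)"
    if y: "y \<in> carrier_vec k" "y \<bullet> y = 1" for y
  proof -
    define r where "r x j = (y \<bullet> (A *\<^sub>v col (B x) j))\<^sup>2 / q A x j" for x j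
    \<comment> \<open>Stretching by \<open>1 + c\<close> multiplies the squared determinant by
      \<open>1 + s\<close>, and \<open>2 * c + c\<^sup>2 = s\<close> makes each squared length grow
      by exactly \<open>1 + s * r x j\<close>.\<close>
    define c where "c = sqrt (1 + s) - 1"
    have c: "(1 + c)\<^sup>2 = 1 + s" "2 * c + c\<^sup>2 = s" "1 + c \<noteq> 0"
      using s by (auto simp: c_def power2_eq_square algebra_simps)
    define G where "G = 1\<^sub>m k + mat k k (\<lambda>(i,j). (c \<cdot>\<^sub>v y) $ i * y $ j)"
    have G: "G \<in> carrier_mat k k" by (simp add: G_def)
    have detG: "det G = 1 + c"
      unfolding G_def using y by (subst det_one_plus_outer) auto
    have detGA: "det (G * A) = (1 + c) * det A" using det_mult[OF G Ac] detG by simp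
    have GA: "G * A \<in> \<A>" using G Ac detGA detA c(3) by (simp add: \<A>_def)
    have r0: "r x j \<ge> 0" for x j
      by (simp add: r_def q_def scalar_prod_self_nonneg)
    have qG: "q (G * A) x j = q A x j * (1 + s * r x j)" if x: "x \<in> X" and j: "j < k" for x j
    proof -
      define v where "v = A *\<^sub>v col (B x) j"
      have bc: "col (B x) j \<in> carrier_vec k" using B[OF x] by auto
      have v: "v \<in> carrier_vec k" using Ac bc unfolding v_def by (intro mult_mat_vec_carrier)
      have "(G * A) *\<^sub>v col (B x) j = G *\<^sub>v v"
        unfolding v_def using G Ac bc by (intro assoc_mult_mat_vec)
      also have "\<dots> = v + (c * (y \<bullet> v)) \<cdot>\<^sub>v y"
        unfolding G_def using y v by (intro stretch_mult_vec)
      finally have "q (G * A) x j = (v + (c * (y \<bullet> v)) \<cdot>\<^sub>v y) \<bullet> (v + (c * (y \<bullet> v)) \<cdot>\<^sub>v y)"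
        by (simp add: q_def)
      also have "\<dots> = v \<bullet> v + (2 * c) * (y \<bullet> v)\<^sup>2 + c\<^sup>2 * (y \<bullet> v)\<^sup>2 * (y \<bullet> y)"
        using y v comm_scalar_prod[OF v y(1)]
        by (simp add: scalar_prod_add_distrib[where n=k] add_scalar_prod_distrib[where n=k]
            power2_eq_square algebra_simps)
      also have "\<dots> = v \<bullet> v + s * (y \<bullet> v)\<^sup>2"
        using y(2) by (simp flip: c(2) add: algebra_simps)
      also have "\<dots> = q A x j * (1 + s * r x j)"
        using q_pos[OF A(1) x j] by (simp add: r_def q_def v_def field_simps)
      finally show ?thesis .
    qed
    define R where "R = (\<Sum>x\<in>X. \<Sum>j<k. r x j)"
    have factor: "\<Psi> (G * A) = \<Psi> A * ((1 + s) ^ n / (\<Prod>x\<in>X. \<Prod>j<k. 1 + s * r x j))"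
    proof -
      have "\<Psi> (G * A) = (\<Prod>x\<in>X. ((det A)\<^sup>2 / (\<Prod>j<k. q A x j)) * ((1 + s) / (\<Prod>j<k. 1 + s * r x j)))"
        unfolding \<Psi>_def using qG
        by (intro prod.cong) (simp_all add: prod.distrib detGA power_mult_distrib c(1))
      also have "\<dots> = \<Psi> A * ((1 + s) ^ n / (\<Prod>x\<in>X. \<Prod>j<k. 1 + s * r x j))"
        unfolding \<Psi>_def n_def by (simp only: prod.distrib prod_dividef prod_constant)
      finally show ?thesis .
    qed
    define E where "E = (\<Prod>x\<in>X. \<Prod>j<k. 1 + s * r x j)"
    \<comment> \<open>From \<open>1 + t \<le> exp t\<close>: the product of the length factors is
      controlled by the sum \<open>R\<close> that has to be bounded from below.\<close>
    have "E \<le> (\<Prod>x\<in>X. \<Prod>j<k. exp (s * r x j))"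
      unfolding E_def using r0 s by (intro prod_mono conjI prod_nonneg) (auto intro: add_nonneg_nonneg)
    also have "\<dots> = exp (s * R)"
      unfolding R_def using X by (simp add: exp_sum sum_distrib_left)
    finally have E_le: "E \<le> exp (s * R)" .
    have E_pos: "E > 0" unfolding E_def using r0 s by (intro prod_pos) (auto intro!: prod_pos add_pos_nonneg)
    have "\<Psi> A * ((1 + s) ^ n / E) \<le> M" using le_M[OF GA] factor by (simp add: E_def)
    also have "M < \<Psi> A * exp (s\<^sup>2)"
      using A(2) by (simp add: exp_minus field_simps)
    finally have "(1 + s) ^ n / E < exp (s\<^sup>2)"
      using \<Psi>_pos[OF A(1)] by (simp only: mult_less_cancel_left_pos)
    then have "(1 + s) ^ n < exp (s\<^sup>2) * E" using E_pos by (simp add: field_simps)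
    also have "\<dots> \<le> exp (s\<^sup>2) * exp (s * R)" using E_le by simp
    finally have "(1 + s) ^ n < exp (s\<^sup>2 + s * R)" by (simp add: exp_add)
    moreover have "exp (real n * (s - s\<^sup>2)) \<le> (1 + s) ^ n"
    proof -
      have "s - s\<^sup>2 \<le> ln (1 + s)" using s by (intro ln_one_plus_pos_lower_bound) auto
      then have "exp (s - s\<^sup>2) \<le> exp (ln (1 + s))" by (simp only: exp_le_cancel_iff)
      also have "\<dots> = 1 + s" using s by simp
      finally have "exp (s - s\<^sup>2) \<le> 1 + s" .
      then have "exp (s - s\<^sup>2) ^ n \<le> (1 + s) ^ n" by (intro power_mono) auto
      then show ?thesis by (simp add: exp_of_nat_mult)
    qed
    \<comment> \<open>Comparing exponents and dividing by \<open>s\<close> gives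
      \<open>n * (1 - s) < s + R\<close>; as \<open>n \<ge> 1\<close>, the extra \<open>s\<close> is
      at most \<open>s * n\<close>, which leaves \<open>R > n * (1 - 2 * s)\<close>.\<close>
    ultimately have "exp (real n * (s - s\<^sup>2)) < exp (s\<^sup>2 + s * R)" by linarith
    then have "s * (real n * (1 - s)) < s * (s + R)"
      by (simp add: power2_eq_square algebra_simps)
    then have "real n * (1 - s) < s + R" using s by simp
    moreover have "s \<le> s * real n" using n s by simp
    moreover have "2 * s * real n \<le> e * real n" using s by (intro mult_right_mono) auto
    ultimately have "(1 - e) * real n \<le> R" by (simp add: algebra_simps)
    then show ?thesis by (simp add: R_def r_def n_def)
  qed
  then show ?thesis using that[OF Ac detA] by (simp add: q_def)
qed

section \<open>Forster's argument for sign matrices with orthogonal columns\<close>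

text \<open>The columns are \<open>t\<close> times \<open>u\<close> plus the unit vectors. For large
  \<open>t\<close> their directions approach \<open>u\<close>, so finitely many strict inequalities
  persist, while the determinant is affine in \<open>t\<close> with value 1 at 0 and vanishes at
  most once.\<close>

lemma exists_basis_near:
  fixes u :: "real Matrix.vec"
  assumes u: "u \<in> carrier_vec k" and W: "finite W" "\<And>w. w \<in> W \<Longrightarrow> w \<in> carrier_vec k"
    and pos: "\<And>w. w \<in> W \<Longrightarrow> w \<bullet> u > 0"
  obtains B where "B \<in> carrier_mat k k" "det B \<noteq> 0" "\<And>w j. w \<in> W \<Longrightarrow> j < k \<Longrightarrow> w \<bullet> col B j > 0"
proof -
  define one where "one = Matrix.vec k (\<lambda>_. 1::real)"
  define B where "B t = 1\<^sub>m k + mat k k (\<lambda>(i,j). (t \<cdot>\<^sub>v u) $ i * one $ j)" for t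
  have c: "B t \<in> carrier_mat k k" for t by (simp add: B_def)
  have detB: "det (B t) = 1 + t * (u \<bullet> one)" for t
    unfolding B_def using u by (subst det_one_plus_outer) (auto simp: one_def)
  have colB: "w \<bullet> col (B t) j = w $ j + t * (w \<bullet> u)" if "w \<in> W" "j < k" for w t j
  proof -
    have "col (B t) j = unit_vec k j + t \<cdot>\<^sub>v u"
      using u that by (intro eq_vecI) (auto simp: B_def one_def)
    then show ?thesis
      using u W(2)[OF that(1)] that(2) by (simp add: scalar_prod_add_distrib[where n = k])
  qed
  have "\<forall>\<^sub>F t in at_top. 1 + t * (u \<bullet> one) \<noteq> 0"
    \<comment> \<open>Beyond the only possible zero of the determinant. If
      \<open>u \<bullet> one = 0\<close> the quotient is 0 by convention and the determinant is
      constantly 1.\<close>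
    using eventually_gt_at_top[of "max 0 (- 1 / (u \<bullet> one))"]
  proof eventually_elim
    case (elim t)
    show ?case
    proof
      assume eq: "1 + t * (u \<bullet> one) = 0"
      then have "u \<bullet> one \<noteq> 0" by auto
      with eq have "t = - 1 / (u \<bullet> one)" by (simp add: nonzero_eq_divide_eq del: divide_minus_left)
      with elim show False by simp
    qed
  qed
  moreover have "\<forall>\<^sub>F t in at_top. \<forall>w\<in>W. \<forall>j\<in>{..<k}. w $ j + t * (w \<bullet> u) > 0"
  proof (intro eventually_ball_finite ballI W(1))
    fix w j assume "w \<in> W"
    show "\<forall>\<^sub>F t in at_top. w $ j + t * (w \<bullet> u) > 0"
      using eventually_gt_at_top[of "- (w $ j) / (w \<bullet> u)"]
      by eventually_elim (use pos[OF \<open>w \<in> W\<close>] in \<open>auto simp: field_simps\<close>)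
  qed simp
  ultimately have "\<forall>\<^sub>F t in at_top. 1 + t * (u \<bullet> one) \<noteq> 0 \<and>
      (\<forall>w\<in>W. \<forall>j\<in>{..<k}. w $ j + t * (w \<bullet> u) > 0)"
    by (rule eventually_conj)
  then obtain t where "1 + t * (u \<bullet> one) \<noteq> 0" "\<forall>w\<in>W. \<forall>j\<in>{..<k}. w $ j + t * (w \<bullet> u) > 0"
    using eventually_happens'[OF trivial_limit_at_top_linorder] by blast
  then show ?thesis using that[OF c[of t]] detB colB by auto
qed

text \<open>Parseval's identity: the Gram matrix of the columns is \<open>card Y\<close> times the
  identity. It takes the place of the operator norm of \<open>M\<close> in Forster's bound.\<close>

lemma sum_sq_orthogonal_columns:
  fixes M :: "'b \<Rightarrow> 'a \<Rightarrow> real"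
  assumes X: "finite X"
    and unit: "\<And>x y. x \<in> X \<Longrightarrow> y \<in> Y \<Longrightarrow> \<bar>M y x\<bar> = 1"
    and orth: "\<And>x x'. x \<in> X \<Longrightarrow> x' \<in> X \<Longrightarrow> x \<noteq> x' \<Longrightarrow> (\<Sum>y\<in>Y. M y x * M y x') = 0"
  shows "(\<Sum>y\<in>Y. (\<Sum>x\<in>X. M y x * c x)\<^sup>2) = real (card Y) * (\<Sum>x\<in>X. (c x)\<^sup>2)"
proof -
  have diag: "(\<Sum>y\<in>Y. M y x * M y x') = (if x = x' then real (card Y) else 0)"
    if "x \<in> X" "x' \<in> X" for x x'
  proof (cases "x = x'")
    case True
    have "M y x * M y x = 1" if "y \<in> Y" for y
      using unit[OF \<open>x \<in> X\<close> that] by (metis abs_mult_self_eq mult_1)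
    then show ?thesis using True by simp
  qed (use orth that in auto)
  have "(\<Sum>y\<in>Y. (\<Sum>x\<in>X. M y x * c x)\<^sup>2)
      = (\<Sum>y\<in>Y. \<Sum>x\<in>X. \<Sum>x'\<in>X. (c x * c x') * (M y x * M y x'))"
    by (simp add: power2_eq_square sum_product mult_ac)
  also have "\<dots> = (\<Sum>x\<in>X. \<Sum>x'\<in>X. (c x * c x') * (\<Sum>y\<in>Y. M y x * M y x'))"
    by (subst sum.swap, rule sum.cong[OF refl], subst sum.swap) (simp add: sum_distrib_left)
  also have "\<dots> = (\<Sum>x\<in>X. \<Sum>x'\<in>X. if x = x' then (c x)\<^sup>2 * real (card Y) else 0)"
    using diag by (intro sum.cong) (auto simp: power2_eq_square)
  also have "\<dots> = real (card Y) * (\<Sum>x\<in>X. (c x)\<^sup>2)"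
    using X by (simp add: sum_distrib_left mult.commute)
  finally show ?thesis .
qed

lemma left_inverse_of_det_nonzero:
  fixes A :: "real mat"
  assumes A: "A \<in> carrier_mat k k" and "det A \<noteq> 0"
  obtains C where "C \<in> carrier_mat k k" "C * A = 1\<^sub>m k"
  using det_non_zero_imp_unit[OF assms, of "()"] unfolding Units_def ring_mat_simps by auto

text \<open>A sum \<open>T\<close> of signed cosines is bounded in two ways. In near-isotropic
  position it is at least about \<open>m * n\<close>, because numbers in [0, 1] dominate their
  squares; by Cauchy-Schwarz and orthogonality of the columns it is at most
  \<open>m * sqrt n * k\<close>.\<close>

theorem forster_sign_rank:
  fixes M :: "'b \<Rightarrow> 'a \<Rightarrow> real" and u :: "'a \<Rightarrow> real Matrix.vec" and w :: "'b \<Rightarrow> real Matrix.vec"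
  assumes X: "finite X" and Y: "finite Y" "Y \<noteq> {}"
    and u: "\<And>x. x \<in> X \<Longrightarrow> u x \<in> carrier_vec k" and w: "\<And>y. y \<in> Y \<Longrightarrow> w y \<in> carrier_vec k"
    and sign: "\<And>x y. x \<in> X \<Longrightarrow> y \<in> Y \<Longrightarrow> M y x * (w y \<bullet> u x) > 0"
    and unit: "\<And>x y. x \<in> X \<Longrightarrow> y \<in> Y \<Longrightarrow> \<bar>M y x\<bar> = 1"
    and orth: "\<And>x x'. x \<in> X \<Longrightarrow> x' \<in> X \<Longrightarrow> x \<noteq> x' \<Longrightarrow> (\<Sum>y\<in>Y. M y x * M y x') = 0"
  shows "sqrt (real (card X)) \<le> real k"
\<comment> \<open>The factor \<open>z < 1\<close> absorbs the defect \<open>e = 1 - z\<close> of the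
  approximate isotropic position.\<close>
proof (rule field_le_mult_one_interval)
  fix z :: real assume z: "0 < z" "z < 1"
  define n m where "n = real (card X)" and "m = real (card Y)"
  have m: "m > 0" using Y by (simp add: m_def card_gt_0_iff)
  have "\<exists>B. B \<in> carrier_mat k k \<and> det B \<noteq> 0 \<and> (\<forall>y\<in>Y. \<forall>j<k. M y x * (w y \<bullet> col B j) > 0)"
    if x: "x \<in> X" for x
  proof -
    have "\<And>v. v \<in> (\<lambda>y. M y x \<cdot>\<^sub>v w y) ` Y \<Longrightarrow> v \<in> carrier_vec k"
      and "\<And>v. v \<in> (\<lambda>y. M y x \<cdot>\<^sub>v w y) ` Y \<Longrightarrow> v \<bullet> u x > 0"
      using w u[OF x] sign[OF x] by auto
    then obtain B where B: "B \<in> carrier_mat k k" "det B \<noteq> 0"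
      "\<And>v j. v \<in> (\<lambda>y. M y x \<cdot>\<^sub>v w y) ` Y \<Longrightarrow> j < k \<Longrightarrow> v \<bullet> col B j > 0"
      using exists_basis_near[OF u[OF x], of "(\<lambda>y. M y x \<cdot>\<^sub>v w y) ` Y"] Y(1) by blast
    have "M y x * (w y \<bullet> col B j) > 0" if "y \<in> Y" "j < k" for y j
      using B(3)[of "M y x \<cdot>\<^sub>v w y" j] that w[OF that(1)] B(1) by auto
    with B show ?thesis by blast
  qed
  then obtain B where B: "\<And>x. x \<in> X \<Longrightarrow> B x \<in> carrier_mat k k" "\<And>x. x \<in> X \<Longrightarrow> det (B x) \<noteq> 0"
    and signB: "\<And>x y j. x \<in> X \<Longrightarrow> y \<in> Y \<Longrightarrow> j < k \<Longrightarrow> M y x * (w y \<bullet> col (B x) j) > 0"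
    by metis
  obtain A where A: "A \<in> carrier_mat k k" "det A \<noteq> 0"
    and iso: "\<And>y. y \<in> carrier_vec k \<Longrightarrow> y \<bullet> y = 1 \<Longrightarrow>
       z * real (card X) \<le> (\<Sum>x\<in>X. \<Sum>j<k. (y \<bullet> (A *\<^sub>v col (B x) j))\<^sup>2
          / ((A *\<^sub>v col (B x) j) \<bullet> (A *\<^sub>v col (B x) j)))"
    by (rule approx_isotropic_position[where e = "1 - z", OF X B]) (use z in auto)
  obtain C where C: "C \<in> carrier_mat k k" "C * A = 1\<^sub>m k"
    using left_inverse_of_det_nonzero[OF A] .
  define a where "a x j = A *\<^sub>v col (B x) j" for x j
  define q where "q x j = a x j \<bullet> a x j" for x j
  \<comment> \<open>The inverse transpose acts on the \<open>w y\<close>, so that moving the basis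
    vectors by \<open>A\<close> leaves every pairing, and hence every sign, unchanged.\<close>
  define p where "p y = transpose_mat C *\<^sub>v w y" for y
  define h where "h y = (1 / sqrt (p y \<bullet> p y)) \<cdot>\<^sub>v p y" for y
  have a: "a x j \<in> carrier_vec k" if "x \<in> X" for x j
    using A B[OF that] unfolding a_def by (intro mult_mat_vec_carrier) auto
  have p: "p y \<in> carrier_vec k" if "y \<in> Y" for y
    using C w[OF that] unfolding p_def by (intro mult_mat_vec_carrier) auto
  have pa: "p y \<bullet> a x j = w y \<bullet> col (B x) j" if "x \<in> X" "y \<in> Y" for x y j
  proof -
    have col: "col (B x) j \<in> carrier_vec k" using B[OF that(1)] by auto
    have "p y \<bullet> a x j = w y \<bullet> (C *\<^sub>v a x j)"
      unfolding p_def using C a[OF that(1)] w[OF that(2)] by (intro transpose_vec_mult_scalar)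
    also have "C *\<^sub>v a x j = (C * A) *\<^sub>v col (B x) j"
      unfolding a_def using C A col by (intro assoc_mult_mat_vec[symmetric])
    finally show ?thesis using C(2) col by simp
  qed
  have posqp: "q x j > 0 \<and> p y \<bullet> p y > 0" if "x \<in> X" "y \<in> Y" "j < k" for x y j
  proof -
    have "p y \<bullet> a x j \<noteq> 0" using signB[OF that] pa[OF that(1,2)] by auto
    then have "0 < (p y \<bullet> a x j)\<^sup>2" by simp
    also have "\<dots> \<le> (p y \<bullet> p y) * (a x j \<bullet> a x j)"
      using p a that by (intro scalar_prod_Cauchy_Schwarz)
    finally show ?thesis
      using scalar_prod_self_nonneg[of "p y"] scalar_prod_self_nonneg[of "a x j"]
      by (auto simp: q_def zero_less_mult_iff)
  qed
  show "z * sqrt (real (card X)) \<le> real k"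
  proof (cases "X = {} \<or> k = 0")
    case True
    then show ?thesis
    proof
      assume "k = 0"
      \<comment> \<open>In dimension 0 all scalar products are empty sums, which the strict sign
        condition excludes.\<close>
      have "X = {}"
      proof (rule ccontr)
        assume "X \<noteq> {}"
        with Y obtain x y where "x \<in> X" "y \<in> Y" by auto
        then show False using sign[of x y] u[of x] w[of y] \<open>k = 0\<close> by (auto simp: scalar_prod_def)
      qed
      then show ?thesis by simp
    qed simp
  next
    case False
    then have n: "n > 0" using X by (simp add: n_def card_gt_0_iff)
    have pp: "p y \<bullet> p y > 0" if "y \<in> Y" for y using posqp False that by blast
    have h: "h y \<in> carrier_vec k" "h y \<bullet> h y = 1" if "y \<in> Y" for y
      using pp[OF that] p[OF that] by (auto simp: h_def real_sqrt_mult_self simp flip: power2_eq_square) 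
    \<comment> \<open>The cosine of the angle between \<open>h y\<close> and \<open>a x j\<close>,
      with the sign of \<open>M\<close>: it lies in [0, 1], so its square is at most itself.\<close>
    define t where "t y x j = M y x * (h y \<bullet> a x j) / sqrt (q x j)" for y x j
    define T where "T = (\<Sum>y\<in>Y. \<Sum>x\<in>X. \<Sum>j<k. t y x j)"
    have t_ge: "(h y \<bullet> a x j)\<^sup>2 / q x j \<le> t y x j" if xyj: "x \<in> X" "y \<in> Y" "j < k" for x y j
    proof -
      have t0: "t y x j \<ge> 0"
        using signB[OF xyj] pa[OF xyj(1,2), of j] p[OF xyj(2)] a[OF xyj(1), of j] pp[OF xyj(2)] posqp[OF xyj]
        by (simp add: t_def h_def)
      have "(M y x)\<^sup>2 = 1" using unit[OF xyj(1,2)] by (metis power2_abs one_power2)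
      then have t2: "(t y x j)\<^sup>2 = (h y \<bullet> a x j)\<^sup>2 / q x j"
        using posqp[OF xyj] by (simp add: t_def power_divide power_mult_distrib)
      have "(h y \<bullet> a x j)\<^sup>2 \<le> (h y \<bullet> h y) * q x j"
        unfolding q_def using h a xyj by (intro scalar_prod_Cauchy_Schwarz)
      then have "(t y x j)\<^sup>2 \<le> 1" using t2 h(2)[OF xyj(2)] posqp[OF xyj] by simp
      then have "t y x j \<le> 1" using t0 by (simp add: power_le_one_iff)
      then have "(t y x j)\<^sup>2 \<le> t y x j" using t0 by (simp add: power2_eq_square mult_left_le)
      then show ?thesis using t2 by simp
    qed
    have "m * (z * n) = (\<Sum>y\<in>Y. z * n)" by (simp add: m_def)
    also have "\<dots> \<le> (\<Sum>y\<in>Y. \<Sum>x\<in>X. \<Sum>j<k. (h y \<bullet> a x j)\<^sup>2 / q x j)"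
      using iso[OF h] by (intro sum_mono) (simp add: a_def q_def n_def)
    also have "\<dots> \<le> T" unfolding T_def using t_ge by (intro sum_mono) auto
    finally have lower: "m * (z * n) \<le> T" .
    \<comment> \<open>Coordinate \<open>i\<close> of the sum of the \<open>k\<close> normalised
      basis images at \<open>x\<close>. Thus \<open>T\<close> pairs each unit vector
      \<open>h y\<close> with the sum over \<open>x\<close> of \<open>M y x\<close> times the vector
      \<open>V x\<close>.\<close>
    define V where "V x i = (\<Sum>j<k. a x j $ i / sqrt (q x j))" for x i
    have "T = (\<Sum>y\<in>Y. \<Sum>x\<in>X. \<Sum>j<k. \<Sum>i<k. h y $ i * (M y x * (a x j $ i / sqrt (q x j))))"
      unfolding T_def t_def using a
      by (intro sum.cong refl)
         (simp add: scalar_prod_def sum_distrib_left sum_divide_distrib atLeast0LessThan mult_ac carrier_vecD[OF a])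
    also have "\<dots> = (\<Sum>y\<in>Y. \<Sum>x\<in>X. \<Sum>i<k. h y $ i * (M y x * V x i))"
      unfolding V_def sum_distrib_left by (intro sum.cong refl sum.swap)
    also have "\<dots> = (\<Sum>y\<in>Y. \<Sum>i<k. h y $ i * (\<Sum>x\<in>X. M y x * V x i))"
      unfolding sum_distrib_left by (intro sum.cong refl sum.swap)
    also have "\<dots> = (\<Sum>(y,i)\<in>Y \<times> {..<k}. h y $ i * (\<Sum>x\<in>X. M y x * V x i))"
      by (simp add: sum.cartesian_product)
    finally have "T\<^sup>2 = (\<Sum>c\<in>Y \<times> {..<k}. h (fst c) $ snd c * (\<Sum>x\<in>X. M (fst c) x * V x (snd c)))\<^sup>2"
      by (simp add: case_prod_unfold)
    \<comment> \<open>One Cauchy-Schwarz over all pairs of a row and a coordinate: the unit vectors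
      contribute \<open>m\<close>, and the other factor is evaluated coordinate by coordinate with
      Parseval.\<close>
    also have "\<dots> \<le> (\<Sum>c\<in>Y \<times> {..<k}. (h (fst c) $ snd c)\<^sup>2)
        * (\<Sum>c\<in>Y \<times> {..<k}. (\<Sum>x\<in>X. M (fst c) x * V x (snd c))\<^sup>2)"
      by (rule Cauchy_Schwarz_ineq_sum)
    also have "(\<Sum>c\<in>Y \<times> {..<k}. (h (fst c) $ snd c)\<^sup>2) = (\<Sum>y\<in>Y. \<Sum>i<k. (h y $ i)\<^sup>2)"
      by (simp add: sum.cartesian_product case_prod_unfold)
    also have "\<dots> = (\<Sum>y\<in>Y. h y \<bullet> h y)"
      by (intro sum.cong refl)
        (simp add: scalar_prod_def power2_eq_square atLeast0LessThan carrier_vecD[OF h(1)])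
    also have "\<dots> = m" using h(2) by (simp add: m_def)
    also have "(\<Sum>c\<in>Y \<times> {..<k}. (\<Sum>x\<in>X. M (fst c) x * V x (snd c))\<^sup>2)
        = (\<Sum>i<k. \<Sum>y\<in>Y. (\<Sum>x\<in>X. M y x * V x i)\<^sup>2)"
      by (subst sum.swap) (simp add: sum.cartesian_product case_prod_unfold)
    also have "\<dots> = (\<Sum>i<k. m * (\<Sum>x\<in>X. (V x i)\<^sup>2))"
      unfolding m_def using X unit orth by (intro sum.cong refl sum_sq_orthogonal_columns)
    also have "\<dots> = m * (\<Sum>x\<in>X. \<Sum>i<k. (V x i)\<^sup>2)"
      by (subst sum.swap) (simp add: sum_distrib_left)
    finally have T2: "T\<^sup>2 \<le> m * (m * (\<Sum>x\<in>X. \<Sum>i<k. (V x i)\<^sup>2))" .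
    \<comment> \<open>A sum of \<open>k\<close> unit vectors has length at most
      \<open>k\<close>.\<close>
    have "(\<Sum>i<k. (V x i)\<^sup>2) \<le> (real k)\<^sup>2" if x: "x \<in> X" for x
    proof -
      have qx: "q x j > 0" if "j < k" for j using posqp[OF x _ that] Y(2) by auto
      have "(\<Sum>i<k. (V x i)\<^sup>2) \<le> (\<Sum>i<k. (\<Sum>j<k. (a x j $ i / sqrt (q x j))\<^sup>2) * real (card {..<k}))"
        unfolding V_def by (intro sum_mono sum_squared_le_sum_of_squares)
      also have "\<dots> = real k * (\<Sum>i<k. \<Sum>j<k. (a x j $ i)\<^sup>2 / q x j)"
        by (simp add: sum_distrib_left power_divide mult_ac q_def scalar_prod_self_nonneg)
      also have "(\<Sum>i<k. \<Sum>j<k. (a x j $ i)\<^sup>2 / q x j) = (\<Sum>j<k. \<Sum>i<k. (a x j $ i)\<^sup>2 / q x j)"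
        by (rule sum.swap)
      also have "(\<Sum>j<k. \<Sum>i<k. (a x j $ i)\<^sup>2 / q x j) = (\<Sum>j<k. q x j / q x j)"
        unfolding sum_divide_distrib[symmetric]
        by (simp add: q_def scalar_prod_def power2_eq_square atLeast0LessThan carrier_vecD[OF a[OF x]])
      also have "\<dots> = (\<Sum>j<k. 1)" by (intro sum.cong refl) (auto dest!: qx)
      finally show ?thesis by (simp add: power2_eq_square)
    qed
    then have "(\<Sum>x\<in>X. \<Sum>i<k. (V x i)\<^sup>2) \<le> n * (real k)\<^sup>2"
      unfolding n_def by (rule sum_bounded_above)
    then have "T\<^sup>2 \<le> m * (m * (n * (real k)\<^sup>2))"
      using T2 m by (smt (verit) mult_left_mono)
    also have "\<dots> = (m * sqrt n * real k)\<^sup>2" using n by (simp add: power_mult_distrib power2_eq_square)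
    finally have "T \<le> m * sqrt n * real k"
      using m n by (intro power2_le_imp_le[of T]) auto
    with lower have "m * (z * n) \<le> m * (sqrt n * real k)" by (simp add: mult.assoc)
    then have "z * n \<le> sqrt n * real k" using m by simp
    moreover have "z * n = sqrt n * (z * sqrt n)" using n by simp
    ultimately have "sqrt n * (z * sqrt n) \<le> sqrt n * real k" by simp
    then have "z * sqrt n \<le> real k" using n by (simp only: mult_le_cancel_left_pos real_sqrt_gt_zero)
    then show ?thesis by (simp add: n_def)
  qed
qed

section \<open>Parities on the cube\<close>

text \<open>Every star sequence is an eluder sequence, since passing from all \<open>j\<close> other
  than \<open>i\<close> to the \<open>j\<close> below \<open>i\<close> drops nonnegative
  terms.\<close>

lemma Sdim_le_Edim: "Sdim X F \<epsilon> \<le> Edim X F \<epsilon>"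
proof -
  have "Sdim_at X F \<epsilon> g \<le> Edim_at X F \<epsilon> g" for g
    unfolding Sdim_at_def Edim_at_def
  proof (rule Sup_subset_mono, clarsimp)
    fix m and x :: "nat \<Rightarrow> 'a" and f :: "nat \<Rightarrow> 'a \<Rightarrow> real"
    assume H: "\<forall>i\<in>{Suc 0..m}. x i \<in> X \<and> f i \<in> F \<and> \<epsilon> < \<bar>f i (x i) - g (x i)\<bar> \<and>
      (\<Sum>j\<in>{Suc 0..m} - {i}. (f i (x j) - g (x j))\<^sup>2) \<le> \<epsilon>\<^sup>2"
    have "(\<Sum>j\<in>{Suc 0..<i}. (f i (x j) - g (x j))\<^sup>2) \<le> \<epsilon>\<^sup>2" if "i \<in> {Suc 0..m}" for i
    proof -
      have "(\<Sum>j\<in>{Suc 0..<i}. (f i (x j) - g (x j))\<^sup>2) \<le> (\<Sum>j\<in>{Suc 0..m} - {i}. (f i (x j) - g (x j))\<^sup>2)"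
        using that by (intro sum_mono2) auto
      with H that show ?thesis by fastforce
    qed
    with H show "\<exists>x f. \<forall>i\<in>{Suc 0..m}. x i \<in> X \<and> f i \<in> F \<and> \<epsilon> < \<bar>f i (x i) - g (x i)\<bar> \<and>
      (\<Sum>j\<in>{Suc 0..<i}. (f i (x j) - g (x j))\<^sup>2) \<le> \<epsilon>\<^sup>2" by blast
  qed
  then show ?thesis unfolding Sdim_def Edim_def by (intro SUP_mono) auto
qed

section \<open>The cube as a vector space over the two-element field, and eluder sequences of
  parities\<close>

lemma card_cube: "card (cube d) = 2 ^ d"
  by (simp add: cube_def card_PiE numeral_2_eq_2)

lemma finite_cube [simp]: "finite (cube d)"
  by (simp add: cube_def finite_PiE)

lemma cube_coord: "x \<in> cube d \<Longrightarrow> i \<in> {1..d} \<Longrightarrow> x i = 1 \<or> x i = -1"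
  by (auto simp: cube_def)

lemma prod_pm_one:
  assumes "\<And>i. i \<in> S \<Longrightarrow> f i = 1 \<or> f i = (-1::real)"
  shows "prod f S = 1 \<or> prod f S = -1"
  using assms by (induction S rule: infinite_finite_induct) force+

lemma parity_pm_one:
  assumes "x \<in> cube d" "f \<in> parities d"
  shows "f x = 1 \<or> f x = -1"
proof -
  from assms obtain S where S: "S \<subseteq> {1..d}" "f x = (\<Prod>i\<in>S. x i)" by (auto simp: parities_def)
  show ?thesis unfolding S(2)
    using S(1) cube_coord[OF assms(1)] by (intro prod_pm_one) blast
qed

text \<open>In multiplicative notation, the linear combination over the two-element field whose
  coefficients are the indicator of \<open>J\<close>; the empty set gives the all-ones
  point.\<close>

definition cube_mult :: "nat \<Rightarrow> (nat \<Rightarrow> nat \<Rightarrow> real) \<Rightarrow> nat set \<Rightarrow> nat \<Rightarrow> real" where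
  "cube_mult d x J = restrict (\<lambda>k. \<Prod>j\<in>J. x j k) {1..d}"

lemma cube_mult_in_cube:
  assumes "\<And>j. j \<in> J \<Longrightarrow> x j \<in> cube d"
  shows "cube_mult d x J \<in> cube d"
proof -
  have "(\<Prod>j\<in>J. x j k) = 1 \<or> (\<Prod>j\<in>J. x j k) = -1" if "k \<in> {1..d}" for k
    using assms cube_coord that by (intro prod_pm_one) blast
  then show ?thesis by (force simp: cube_mult_def cube_def)
qed

text \<open>Parities are characters of the cube under coordinatewise multiplication; the two
  products are interchanged.\<close>

lemma parity_cube_mult:
  assumes "\<And>j. j \<in> J \<Longrightarrow> x j \<in> cube d" "f \<in> parities d"
  shows "f (cube_mult d x J) = (\<Prod>j\<in>J. f (x j))"
proof -
  from assms(2) obtain S where S: "S \<subseteq> {1..d}" "f = restrict (\<lambda>x. \<Prod>i\<in>S. x i) (cube d)"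
    by (auto simp: parities_def)
  have "f (cube_mult d x J) = (\<Prod>i\<in>S. cube_mult d x J i)"
    using S(2) cube_mult_in_cube[OF assms(1)] by simp
  also have "\<dots> = (\<Prod>i\<in>S. \<Prod>j\<in>J. x j i)"
    using S(1) by (intro prod.cong) (auto simp: cube_mult_def)
  also have "\<dots> = (\<Prod>j\<in>J. \<Prod>i\<in>S. x j i)" by (rule prod.swap)
  also have "\<dots> = (\<Prod>j\<in>J. f (x j))" using S(2) assms(1) by simp
  finally show ?thesis .
qed

text \<open>If \<open>k\<close> is the largest index on which two index sets differ, the \<open>k\<close>-th witness \<open>f k\<close> and \<open>g\<close>
  multiply to different signs on the corresponding products.\<close>
lemma parity_independent_bound:
  fixes x :: "nat \<Rightarrow> nat \<Rightarrow> real"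
  assumes x: "\<And>i. i \<in> {1..m} \<Longrightarrow> x i \<in> cube d" and f: "\<And>i. i \<in> {1..m} \<Longrightarrow> f i \<in> parities d"
    and g: "g \<in> parities d"
    and ne: "\<And>i. i \<in> {1..m} \<Longrightarrow> f i (x i) \<noteq> g (x i)"
    and eq: "\<And>i j. i \<in> {1..m} \<Longrightarrow> j \<in> {1..<i} \<Longrightarrow> f i (x j) = g (x j)"
  shows "m \<le> d"
proof -
  \<comment> \<open>Linear independence of the points: their \<open>2 ^ m\<close> subset products
    are distinct members of a set of size \<open>2 ^ d\<close>.\<close>
  have "inj_on (cube_mult d x) (Pow {1..m})"
  proof (rule inj_onI, rule ccontr)
    fix I J assume I: "I \<in> Pow {1..m}" and J: "J \<in> Pow {1..m}" and IJ: "cube_mult d x I = cube_mult d x J"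
      and "I \<noteq> J"
    define D where "D = (I - J) \<union> (J - I)"
    define k where "k = Max D"
    have D: "finite D" "D \<noteq> {}" "D \<subseteq> {1..m}" using I J \<open>I \<noteq> J\<close>
      unfolding D_def by (auto simp: finite_subset[of _ "{Suc 0..m}"])
    have k: "k \<in> D" using D k_def by simp
    have above: "j \<in> I \<longleftrightarrow> j \<in> J" if "j > k" for j
      using that D Max_ge[of D j] unfolding k_def D_def by fastforce
    \<comment> \<open>The values on the points of the character \<open>f k\<close> times
      \<open>g\<close>: 1 before \<open>k\<close>, -1 at \<open>k\<close>, and unknown after
      \<open>k\<close>, where \<open>I\<close> and \<open>J\<close> agree.\<close>
    define h where "h j = f k (x j) * g (x j)" for j
    have km: "k \<in> {1..m}" using k D by auto
    have pm: "f k (x j) = 1 \<or> f k (x j) = -1" "g (x j) = 1 \<or> g (x j) = -1" if "j \<in> {1..m}" for j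
      using parity_pm_one x f g km that by blast+
    have hk: "h k = -1" using pm[OF km] ne[OF km] by (auto simp: h_def)
    have hl: "h j = 1" if "j \<in> {1..m}" "j < k" for j
      using pm[OF that(1)] eq[OF km, of j] that by (auto simp: h_def)
    have h0: "h j \<noteq> 0" if "j \<in> {1..m}" for j using pm[OF that] by (auto simp: h_def)
    have split: "prod h A = (\<Prod>j\<in>A \<inter> {k<..}. h j) * (if k \<in> A then -1 else 1)" if A: "A \<subseteq> {1..m}" for A
    proof -
      have fin: "finite A" using A finite_subset by auto
      have "prod h A = (\<Prod>j\<in>A \<inter> {k<..}. h j) * (\<Prod>j\<in>A - {k<..}. h j)"
        using fin by (metis Int_commute prod.Int_Diff)
      also have "(\<Prod>j\<in>A - {k<..}. h j) = (\<Prod>j\<in>A - {k<..}. if j = k then -1 else 1)"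
        using A hk hl by (intro prod.cong) auto
      also have "\<dots> = (if k \<in> A then -1 else 1)" using fin by (simp add: prod.delta)
      finally show ?thesis .
    qed
    have H: "prod h A = f k (cube_mult d x A) * g (cube_mult d x A)" if A: "A \<subseteq> {1..m}" for A
      using parity_cube_mult[of A x d "f k"] parity_cube_mult[of A x d g] x A f[OF km] g
      by (auto simp: h_def prod.distrib subset_iff)
    have "I \<inter> {k<..} = J \<inter> {k<..}" using above by auto
    moreover have "prod h I = prod h J" using H[of I] H[of J] I J IJ by simp
    moreover have "(\<Prod>j\<in>J \<inter> {k<..}. h j) \<noteq> 0"
      using J h0 by (auto simp: prod_zero_iff finite_subset[of J "{1..m}"])
    \<comment> \<open>The common nonzero factor beyond \<open>k\<close> cancels, and exactly one of
      \<open>I\<close> and \<open>J\<close> contains \<open>k\<close>, so the two products have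
      opposite signs.\<close>
    ultimately show False using split[of I] split[of J] I J k unfolding D_def
      by (auto split: if_splits)
  qed
  moreover have "cube_mult d x ` Pow {1..m} \<subseteq> cube d"
    using x cube_mult_in_cube by (auto simp: subset_iff)
  ultimately have "card (Pow {1..m}) \<le> card (cube d)"
    by (intro card_inj_on_le) auto
  then show ?thesis by (simp add: card_Pow card_cube)
qed

text \<open>Values of parities differ by 0 or 2 in absolute value. A witness exceeding
  \<open>\<epsilon>\<close> forces \<open>\<epsilon> < 2\<close>, and then a sum of squares below 4
  has only zero terms, so approximate agreement is exact agreement.\<close>

lemma Edim_parities_le:
  assumes "\<epsilon> \<ge> 0"
  shows "Edim (cube d) (parities d) \<epsilon> \<le> enat d"
  unfolding Edim_def Edim_at_def
proof (rule SUP_least, rule Sup_least, clarsimp)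
  fix g m and x :: "nat \<Rightarrow> nat \<Rightarrow> real" and f
  assume g: "g \<in> parities d"
    and H: "\<forall>i\<in>{Suc 0..m}. x i \<in> cube d \<and> f i \<in> parities d \<and> \<epsilon> < \<bar>f i (x i) - g (x i)\<bar> \<and>
      (\<Sum>j\<in>{Suc 0..<i}. (f i (x j) - g (x j))\<^sup>2) \<le> \<epsilon>\<^sup>2"
  show "m \<le> d"
  proof (rule parity_independent_bound[where x = x and f = f and g = g])
    fix i assume i: "i \<in> {1..m}"
    show "x i \<in> cube d" "f i \<in> parities d" using H i by auto
    have "\<epsilon> < \<bar>f i (x i) - g (x i)\<bar>" using H i by auto
    then show "f i (x i) \<noteq> g (x i)" using assms by auto
    fix j assume j: "j \<in> {1..<i}"
    have pm: "f i (x k) = 1 \<or> f i (x k) = -1" "g (x k) = 1 \<or> g (x k) = -1" if "k \<in> {1..m}" for k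
      using parity_pm_one[of "x k" d "f i"] parity_pm_one[of "x k" d g] H i that g by auto
    have "\<epsilon> < \<bar>f i (x i) - g (x i)\<bar>" using H i by auto
    then have "\<epsilon> < 2" using pm[OF i] by auto
    then have "\<epsilon>\<^sup>2 < 2\<^sup>2" using assms by (intro power_strict_mono) auto
    moreover have "(f i (x j) - g (x j))\<^sup>2 \<le> (\<Sum>j\<in>{Suc 0..<i}. (f i (x j) - g (x j))\<^sup>2)"
      using j by (intro member_le_sum) auto
    moreover have "(\<Sum>j\<in>{Suc 0..<i}. (f i (x j) - g (x j))\<^sup>2) \<le> \<epsilon>\<^sup>2" using H i by auto
    ultimately have "(f i (x j) - g (x j))\<^sup>2 < 2\<^sup>2" by linarith
    with pm[of j] i j show "f i (x j) = g (x j)" by auto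
  qed (use g in auto)
qed

section \<open>Rank of the parities under nondecreasing activations\<close>

text \<open>The sum over subsets factors into the product of \<open>x i * x' i + 1\<close>, which
  vanishes at a coordinate where the points differ.\<close>

lemma parities_orthogonal:
  assumes "x \<in> cube d" "x' \<in> cube d" "x \<noteq> x'"
  shows "(\<Sum>S\<in>Pow {1..d}. (\<Prod>i\<in>S. x i) * (\<Prod>i\<in>S. x' i)) = 0"
proof -
  obtain k where k: "k \<in> {1..d}" "x k \<noteq> x' k"
    using assms PiE_ext unfolding cube_def by metis
  then have "x k * x' k + 1 = 0"
    using cube_coord[OF assms(1) k(1)] cube_coord[OF assms(2) k(1)] by auto
  then have "(\<Prod>i\<in>{1..d}. x i * x' i + 1) = 0" using k(1) by (intro prod_zero) auto
  then show ?thesis by (simp add: prod_add prod.distrib)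
qed

lemma finite_sets_separated:
  fixes P N :: "real set"
  assumes fin: "finite P" "finite N" and less: "\<And>p n. p \<in> P \<Longrightarrow> n \<in> N \<Longrightarrow> n < p"
  obtains \<theta> where "\<And>p. p \<in> P \<Longrightarrow> \<theta> < p" "\<And>n. n \<in> N \<Longrightarrow> n < \<theta>"
proof (cases "P = {} \<or> N = {}")
  case True
  then show ?thesis
  proof
    assume "P = {}"
    \<comment> \<open>Inserting 0 keeps \<open>Max\<close> meaningful when both sets are
      empty.\<close>
    moreover have "n < Max (insert 0 N) + 1" if "n \<in> N" for n
    proof -
      have "n \<le> Max (insert 0 N)" using fin that by (intro Max_ge) auto
      then show ?thesis by linarith
    qed
    ultimately show ?thesis using that[of "Max (insert 0 N) + 1"] by blast
  next
    assume "N = {}"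
    moreover have "Min (insert 0 P) - 1 < p" if "p \<in> P" for p
    proof -
      have "Min (insert 0 P) \<le> p" using fin that by (intro Min_le) auto
      then show ?thesis by linarith
    qed
    ultimately show ?thesis using that[of "Min (insert 0 P) - 1"] by blast
  qed
next
  case False
  define \<theta> where "\<theta> = (Max N + Min P) / 2"
  have "Max N < Min P" using False fin less by simp
  then have "Max N < \<theta>" "\<theta> < Min P" by (auto simp: \<theta>_def field_simps)
  then show ?thesis using that[of \<theta>] fin False by auto
qed

lemma M0_mono:
  assumes "\<sigma> \<in> M0"
  shows "mono \<sigma>"
proof (rule monoI)
  fix x y :: real assume "x \<le> y"
  show "\<sigma> x \<le> \<sigma> y"
  proof (cases "x = y")
    case False
    with \<open>x \<le> y\<close> have "x < y" by simp
    moreover from this have "0 \<le> (\<sigma> y - \<sigma> x) / (y - x)" using assms by (auto simp: M0_def)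
    ultimately show ?thesis by (simp add: zero_le_divide_iff)
  qed simp
qed

text \<open>The subtracted 1 pays for the extra dimension that turns a threshold into a sign. A
  threshold exists because a nondecreasing \<open>\<sigma>\<close> cannot send a larger argument to
  -1 and a smaller one to 1.\<close>

lemma parities_mono_rank_ge:
  fixes \<phi> :: "(nat \<Rightarrow> real) \<Rightarrow> nat \<Rightarrow> real" and w :: "((nat \<Rightarrow> real) \<Rightarrow> real) \<Rightarrow> nat \<Rightarrow> real"
  assumes "mono \<sigma>" and rep: "\<And>x f. x \<in> cube d \<Longrightarrow> f \<in> parities d \<Longrightarrow> f x = \<sigma> (dot k (w f) (\<phi> x))"
  shows "2 powr (real d / 2) - 1 \<le> real k"
proof -
  define par where "par S = restrict (\<lambda>x. \<Prod>i\<in>S. x i) (cube d)" for S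
  have par: "par S \<in> parities d" "x \<in> cube d \<Longrightarrow> par S x = (\<Prod>i\<in>S. x i)" if "S \<in> Pow {1..d}" for S x
    using that by (auto simp: par_def parities_def)
  define z where "z = (\<lambda>(S, x). dot k (w (par S)) (\<phi> x))"
  define D where "D r = {c \<in> Pow {1..d} \<times> cube d. par (fst c) (snd c) = r}" for r :: real
  have finD: "finite (D r)" for r unfolding D_def by simp
  have "n < p" if "p \<in> z ` D 1" "n \<in> z ` D (-1)" for p n
  proof (rule ccontr)
    assume "\<not> n < p"
    then have "\<sigma> p \<le> \<sigma> n" using \<open>mono \<sigma>\<close> by (simp add: monoD)
    moreover have "\<sigma> p = 1" "\<sigma> n = -1"
      using that rep par by (auto simp: D_def z_def)
    ultimately show False by simp
  qed
  then obtain \<theta> where \<theta>: "\<And>p. p \<in> z ` D 1 \<Longrightarrow> \<theta> < p" "\<And>n. n \<in> z ` D (-1) \<Longrightarrow> n < \<theta>"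
    using finite_sets_separated[of "z ` D 1" "z ` D (-1)"] finD by blast
  \<comment> \<open>The last coordinate, 1 against \<open>- \<theta>\<close>, makes the affine
    condition homogeneous.\<close>
  define u where "u x = Matrix.vec (Suc k) (\<lambda>i. if i < k then \<phi> x i else 1)" for x
  define v where "v S = Matrix.vec (Suc k) (\<lambda>i. if i < k then w (par S) i else - \<theta>)" for S
  have vu: "v S \<bullet> u x = z (S, x) - \<theta>" for S x
    by (simp add: u_def v_def scalar_prod_def z_def dot_def atLeast0LessThan)
  have "sqrt (real (card (cube d))) \<le> real (Suc k)"
  proof (rule forster_sign_rank[where Y = "Pow {1..d}" and M = "\<lambda>S x. \<Prod>i\<in>S. x i" and u = u and w = v])
    fix x :: "nat \<Rightarrow> real" and S assume xS: "x \<in> cube d" "S \<in> Pow {1..d}"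
    have pm: "par S x = 1 \<or> par S x = -1" using parity_pm_one xS par by blast
    then show "\<bar>\<Prod>i\<in>S. x i\<bar> = 1" using par xS by auto
    have mem: "(S, x) \<in> D (par S x)" using xS by (simp add: D_def)
    from pm show "(\<Prod>i\<in>S. x i) * (v S \<bullet> u x) > 0"
    proof
      assume val: "par S x = 1"
      then have "z (S, x) \<in> z ` D (1)" using mem by auto
      moreover have "(\<Prod>i\<in>S. x i) = 1" using val par(2) xS by simp
      ultimately show ?thesis using \<theta>(1) by (simp add: vu)
    next
      assume val: "par S x = -1"
      then have "z (S, x) \<in> z ` D (-1)" using mem by auto
      moreover have "(\<Prod>i\<in>S. x i) = -1" using val par(2) xS by simp
      ultimately show ?thesis using \<theta>(2) by (simp add: vu)
    qed
  qed (auto simp: u_def v_def parities_orthogonal[simplified])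
  moreover have "sqrt (real (card (cube d))) = 2 powr (real d / 2)"
    by (simp add: card_cube powr_half_sqrt[symmetric] powr_powr powr_realpow[symmetric])
  ultimately show ?thesis by simp
qed

lemma class_rk_parities_ge: "ereal (2 powr (real d / 2) - 1) \<le> ereal_of_enat (class_rk M0 (cube d) (parities d) R)"
proof -
  \<comment> \<open>Rounding up to a natural number moves the bound into \<open>enat\<close>, where
    the infima are taken; this also covers an infinite rank.\<close>
  define c where "c = nat \<lceil>2 powr (real d / 2) - 1\<rceil>"
  have "enat c \<le> act_rk \<sigma> (cube d) (parities d) R" if "\<sigma> \<in> M0" for \<sigma>
    unfolding act_rk_def
  proof (rule Inf_greatest, clarsimp)
    fix k \<phi> w
    assume "\<forall>x\<in>cube d. \<forall>f\<in>parities d. f x = \<sigma> (dot k (w f) (\<phi> x))"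
    then have "2 powr (real d / 2) - 1 \<le> real k"
      using parities_mono_rank_ge[OF M0_mono[OF that], of d k w \<phi>] by blast
    then show "c \<le> k" unfolding c_def by linarith
  qed
  then have "enat c \<le> class_rk M0 (cube d) (parities d) R"
    unfolding class_rk_def by (rule INF_greatest)
  then have "ereal_of_enat (enat c) \<le> ereal_of_enat (class_rk M0 (cube d) (parities d) R)"
    by (simp only: ereal_of_enat_le_iff)
  moreover have "ereal (2 powr (real d / 2) - 1) \<le> ereal_of_enat (enat c)"
    unfolding c_def by simp
  ultimately show ?thesis by (rule order_trans[rotated])
qed

theorem theorem6:
  fixes d :: nat
  assumes "d \<ge> 1"
  shows "(\<forall>R>0. ereal (2 powr (real d / 2) - 1)
              \<le> ereal_of_enat (class_rk M0 (cube d) (parities d) R)) \<and>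
         (\<forall>\<epsilon>\<ge>0. Sdim (cube d) (parities d) \<epsilon> \<le> Edim (cube d) (parities d) \<epsilon> \<and>
                Edim (cube d) (parities d) \<epsilon> \<le> enat d)"
  using class_rk_parities_ge Sdim_le_Edim Edim_parities_le by blast

end
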